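(* Suppose that for every objective upper bound $t\in\mathbb{R}$ such that $t\ge \min_{x\in\mathcal X} c^\top x$ and $v^A(t)>0$, the lower-level ALSO-X problem $\min_{x\in\mathcal X}\{\mathbb{E}_{\mathbb{P}_{\zeta}}[(g(x,\tilde\zeta))_+] : c^\top x\le t\}$ admits a unique optimal solution. Then ALSO-X# is better than ALSO-X, i.e., $v^{A\#}\le v^{A}$.
   Context: Data. $n,m,I$ are positive integers, $[I]=\{1,\dots,I\}$, $\mathcal X\subseteq\mathbb{R}^n$ is a deterministic set (not assumed convex), $c\in\mathbb{R}^n$, $\varepsilon\in(0,1)$, $\theta\ge 0$, $\|\cdot\|$ is a norm on $\mathbb{R}^m$ with dual norm $\|\cdot\|_*$. For $i\in[I]$, $a_i(x)=A_ix+a_i\in\mathbb{R}^m$ and $b_i(x)=B_i^\top x+b_i\in\mathbb{R}$ are affine. $\tilde\zeta$ is a random vector in $\mathbb{R}^m$ with reference distribution $\mathbb{P}_\zeta$, assumed sub-Gaussian: $\mathbb{P}_\zeta\{\|\tilde\zeta\|\ge\tau\}\le C_1\exp(-C_2\tau^2)$ for some constants $C_1,C_2>0$. $(y)_+=\max\{y,0\}$. Put $$g(x,\zeta)=\max_{i\in[I]}\big(\theta\|a_i(x)\|_*+a_i(x)^\top\zeta-b_i(x)\big).$$ DRCCP (distributionally robust chance constrained program under the type $\infty$-Wasserstein ambiguity set, in its equivalent form): $v^*=\min\{c^\top x: x\in\mathcal X,\ \mathbb{P}_\zeta\{g(x,\tilde\zeta)\le0\}\ge1-\varepsilon\}$.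 ALSO-X: $v^A$ is the minimum (infimum) of all $t$ for which there is $x^*\in\arg\min_{x\in\mathcal X}\{\mathbb{E}_{\mathbb{P}_\zeta}[(g(x,\tilde\zeta))_+]: c^\top x\le t\}$ with $\mathbb{P}_\zeta\{g(x^*,\tilde\zeta)\le0\}\ge1-\varepsilon$. $v^A(t)$ denotes the optimal value of this lower-level minimization problem. ALSO-X#: $v^{A\#}$ is the minimum (infimum) of all $t$ for which there is $(x^*,\beta^* )\in\arg\min\{\varepsilon\beta+\mathbb{E}_{\mathbb{P}_\zeta}[(g(x,\tilde\zeta)-\beta)_+]: x\in\mathcal X,\ c^\top x\le t,\ \beta\le0\}$ with $\mathbb{P}_\zeta\{g(x^*,\tilde\zeta)\le0\}\ge1-\varepsilon$. Conventions: an infimum over the empty set is $+\infty$; the lower-level minimization problems (written with $\arg\min$) are understood to attain their minimum whenever they are feasible. *)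

theory Defs
  imports "HOL-Probability.Probability"
begin

text \<open>An arbitrary norm on a Euclidean space, as opposed to the norm supplied by the type class.\<close>

definition is_norm :: "('a::euclidean_space \<Rightarrow> real) \<Rightarrow> bool" where
  "is_norm N \<longleftrightarrow>
     (\<forall>x. 0 \<le> N x) \<and> (\<forall>x. N x = 0 \<longleftrightarrow> x = 0) \<and>
     (\<forall>r x. N (r *\<^sub>R x) = \<bar>r\<bar> * N x) \<and> (\<forall>x y. N (x + y) \<le> N x + N y)"

text \<open>The supremum is over a nonempty bounded set whenever \<open>N\<close> is a norm, so the real-valued
  \<open>Sup\<close> is the genuine supremum.\<close>

definition dual_norm :: "('a::euclidean_space \<Rightarrow> real) \<Rightarrow> 'a \<Rightarrow> real" where
  "dual_norm N y = Sup {y \<bullet> z |z. N z \<le> 1}"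

definition sub_gaussian :: "'a::euclidean_space measure \<Rightarrow> ('a \<Rightarrow> real) \<Rightarrow> bool" where
  "sub_gaussian P N \<longleftrightarrow>
     (\<exists>C1>0. \<exists>C2>0. \<forall>\<tau>\<ge>0. measure P {z \<in> space P. \<tau> \<le> N z} \<le> C1 * exp (- C2 * \<tau>\<^sup>2))"

text \<open>Below, \<open>P\<close> is the distribution of the random vector \<open>\<zeta>\<close>, \<open>g x z\<close> is the constraint function,
  and \<open>t\<close> is the objective upper bound.\<close>

definition chance_ok ::
    "'z measure \<Rightarrow> real \<Rightarrow> ('x \<Rightarrow> 'z \<Rightarrow> real) \<Rightarrow> 'x \<Rightarrow> bool" where
  "chance_ok P \<epsilon> g x \<longleftrightarrow> measure P {z \<in> space P. g x z \<le> 0} \<ge> 1 - \<epsilon>"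

text \<open>Nonemptiness of this set is the condition that \<open>t\<close> is at least the minimum of \<open>c \<bullet> x\<close> over \<open>X\<close>;
  a level \<open>t\<close> equal to an unattained infimum is thereby excluded.\<close>

definition feasible :: "'x::real_inner set \<Rightarrow> 'x \<Rightarrow> real \<Rightarrow> 'x set" where
  "feasible X c t = {x \<in> X. c \<bullet> x \<le> t}"

definition alsox_obj :: "'z measure \<Rightarrow> ('x \<Rightarrow> 'z \<Rightarrow> real) \<Rightarrow> 'x \<Rightarrow> real" where
  "alsox_obj P g x = (\<integral>z. max (g x z) 0 \<partial>P)"

definition alsox_opt ::
    "'z measure \<Rightarrow> ('x \<Rightarrow> 'z \<Rightarrow> real) \<Rightarrow> 'x::real_inner set \<Rightarrow> 'x \<Rightarrow> real \<Rightarrow> 'x \<Rightarrow> bool" where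
  "alsox_opt P g X c t x \<longleftrightarrow> is_arg_min (alsox_obj P g) (\<lambda>x. x \<in> feasible X c t) x"

definition alsox_lower_value ::
    "'z measure \<Rightarrow> ('x \<Rightarrow> 'z \<Rightarrow> real) \<Rightarrow> 'x::real_inner set \<Rightarrow> 'x \<Rightarrow> real \<Rightarrow> ereal" where
  "alsox_lower_value P g X c t = (INF x\<in>feasible X c t. ereal (alsox_obj P g x))"

definition alsox_value ::
    "'z measure \<Rightarrow> real \<Rightarrow> ('x \<Rightarrow> 'z \<Rightarrow> real) \<Rightarrow> 'x::real_inner set \<Rightarrow> 'x \<Rightarrow> ereal" where
  "alsox_value P \<epsilon> g X c =
     Inf {ereal t |t. \<exists>x. alsox_opt P g X c t x \<and> chance_ok P \<epsilon> g x}"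

definition alsox_sharp_obj ::
    "'z measure \<Rightarrow> real \<Rightarrow> ('x \<Rightarrow> 'z \<Rightarrow> real) \<Rightarrow> 'x \<times> real \<Rightarrow> real" where
  "alsox_sharp_obj P \<epsilon> g = (\<lambda>(x, \<beta>). \<epsilon> * \<beta> + (\<integral>z. max (g x z - \<beta>) 0 \<partial>P))"

definition alsox_sharp_opt ::
    "'z measure \<Rightarrow> real \<Rightarrow> ('x \<Rightarrow> 'z \<Rightarrow> real) \<Rightarrow> 'x::real_inner set \<Rightarrow> 'x \<Rightarrow> real \<Rightarrow>
     'x \<times> real \<Rightarrow> bool" where
  "alsox_sharp_opt P \<epsilon> g X c t p \<longleftrightarrow>
     is_arg_min (alsox_sharp_obj P \<epsilon> g) (\<lambda>p. p \<in> feasible X c t \<times> {..0}) p"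

definition alsox_sharp_value ::
    "'z measure \<Rightarrow> real \<Rightarrow> ('x \<Rightarrow> 'z \<Rightarrow> real) \<Rightarrow> 'x::real_inner set \<Rightarrow> 'x \<Rightarrow> ereal" where
  "alsox_sharp_value P \<epsilon> g X c =
     Inf {ereal t |t. \<exists>x \<beta>. alsox_sharp_opt P \<epsilon> g X c t (x, \<beta>) \<and> chance_ok P \<epsilon> g x}"

end

theory Submission
  imports Defs
begin

text \<open>
  Every level \<open>t\<close> that counts for ALSO-X also counts for ALSO-X\<open>#\<close>, so the second infimum ranges over
  a larger set of levels. Fix such a \<open>t\<close> and an optimal pair \<open>(x, \<beta>)\<close> of the lower-level
  ALSO-X\<open>#\<close> problem at \<open>t\<close>; its \<open>x\<close> satisfies the chance constraint for one of two reasons.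

  If \<open>\<beta> < 0\<close>, the competitor \<open>(x, 0)\<close> suffices. Lowering the threshold of the hinge \<open>max (g x z) 0\<close>
  from \<open>0\<close> to \<open>\<beta>\<close> raises it by the full amount \<open>- \<beta>\<close> wherever \<open>g x z \<ge> 0\<close>, hence raises its
  expectation by at least \<open>- \<beta> * P(g x \<ge> 0)\<close> (lemma \<open>hinge_expectation_gap\<close>), whereas the linear term
  falls by only \<open>- \<epsilon> * \<beta>\<close>. As \<open>\<beta>\<close> is at least as good as \<open>0\<close>, this forces
  \<open>P(g x \<ge> 0) \<le> \<epsilon>\<close>.

  If \<open>\<beta> = 0\<close>, the two objectives agree at \<open>(x, 0)\<close>, so \<open>x\<close> solves the lower-level ALSO-X problem.
  Either its optimal value is positive, and by uniqueness \<open>x\<close> is the solution known to satisfy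
  the chance constraint, or it is zero, and \<open>g x \<le> 0\<close> almost surely.

  Both cases use that \<open>g x\<close> is integrable, since otherwise the hinge expectations mean nothing.
  As a maximum of finitely many affine functions of \<open>z\<close>, \<open>g x\<close> is integrable once \<open>norm z\<close> is,
  and this follows from the sub-Gaussian tail because all norms on a Euclidean space are
  equivalent (lemma \<open>sub_gaussian_integrable_norm\<close>).
\<close>

section \<open>Integrability under a sub-Gaussian tail\<close>

lemma is_norm_continuous_on:
  assumes "is_norm N"
  shows "continuous_on UNIV N"
proof -
  have tri: "\<And>x y. N (x + y) \<le> N x + N y" and hom: "\<And>r x. N (r *\<^sub>R x) = \<bar>r\<bar> * N x"
    using assms by (auto simp: is_norm_def)
  have "convex_on UNIV N"
  proof (rule convex_onI)
    fix t :: real and x y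
    assume "0 < t" "t < 1"
    then show "N ((1 - t) *\<^sub>R x + t *\<^sub>R y) \<le> (1 - t) * N x + t * N y"
      using tri[of "(1 - t) *\<^sub>R x" "t *\<^sub>R y"] by (simp add: hom)
  qed simp
  then show ?thesis
    by (intro convex_on_continuous) auto
qed

text \<open>By compactness \<open>N\<close> has a positive minimum on the unit sphere; its reciprocal serves as
  \<open>K\<close> by homogeneity.\<close>

lemma norm_le_is_norm:
  fixes N :: "'a::euclidean_space \<Rightarrow> real"
  assumes "is_norm N"
  shows "\<exists>K>0. \<forall>x. norm x \<le> K * N x"
proof -
  have hom: "\<And>r x. N (r *\<^sub>R x) = \<bar>r\<bar> * N x" and N0: "\<And>x. N x = 0 \<longleftrightarrow> x = 0" "\<And>x. 0 \<le> N x"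
    using assms by (auto simp: is_norm_def)
  have "\<exists>u\<in>sphere 0 1. \<forall>y\<in>sphere 0 (1::real). N u \<le> N (y::'a)"
    by (intro continuous_attains_inf continuous_on_subset[OF is_norm_continuous_on[OF assms]]) auto
  then obtain u :: 'a where u: "norm u = 1" "\<And>y. norm y = 1 \<Longrightarrow> N u \<le> N y"
    by auto
  have "N u > 0"
    using u(1) N0[of u] by (metis less_eq_real_def norm_zero zero_neq_one)
  have "norm x \<le> 1 / N u * N x" for x
  proof (cases "x = 0")
    case False
    then have "N u \<le> N ((1 / norm x) *\<^sub>R x)"
      by (intro u(2)) simp
    then show ?thesis
      using False \<open>N u > 0\<close> by (simp add: hom field_simps)
  qed (simp add: N0)
  then show ?thesis
    using \<open>N u > 0\<close> by (intro exI[of _ "1 / N u"]) simp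
qed

text \<open>The layer-cake bound: \<open>f\<close> is at most the number of naturals \<open>k \<le> f\<close>.\<close>

lemma (in finite_measure) integrable_of_summable_tails:
  fixes f :: "'a \<Rightarrow> real"
  assumes [measurable]: "f \<in> borel_measurable M"
    and nonneg: "\<And>x. 0 \<le> f x"
    and tails: "summable (\<lambda>k. measure M {x \<in> space M. real k \<le> f x})"
  shows "integrable M f"
proof (rule integrableI_nonneg)
  let ?E = "\<lambda>k::nat. {x \<in> space M. real k \<le> f x}"
  have "(\<integral>\<^sup>+x. ennreal (f x) \<partial>M) \<le> (\<integral>\<^sup>+x. (\<Sum>k. indicator (?E k) x) \<partial>M)"
  proof (rule nn_integral_mono)
    fix x assume x: "x \<in> space M"
    have "f x \<le> real (nat \<lfloor>f x\<rfloor> + 1)"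
      using nonneg[of x] by linarith
    then have "ennreal (f x) \<le> of_nat (nat \<lfloor>f x\<rfloor> + 1)"
      by (metis ennreal_leI ennreal_of_nat_eq_real_of_nat)
    also have "\<dots> = (\<Sum>k<nat \<lfloor>f x\<rfloor> + 1. indicator (?E k) x)"
    proof -
      have "indicator (?E k) x = (1::ennreal)" if "k < nat \<lfloor>f x\<rfloor> + 1" for k
      proof -
        have "real k \<le> f x"
          using that nonneg[of x] by linarith
        then show ?thesis using x by simp
      qed
      then show ?thesis by simp
    qed
    also have "\<dots> \<le> (\<Sum>k. indicator (?E k) x)"
      by (intro sum_le_suminf) auto
    finally show "ennreal (f x) \<le> (\<Sum>k. indicator (?E k) x)" .
  qed
  also have "\<dots> = (\<Sum>k. ennreal (measure M (?E k)))"
    by (subst nn_integral_suminf) (auto simp: emeasure_eq_measure)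
  also have "\<dots> = ennreal (\<Sum>k. measure M (?E k))"
    using tails by (intro suminf_ennreal2) auto
  also have "\<dots> < \<infinity>"
    by simp
  finally show "(\<integral>\<^sup>+x. ennreal (f x) \<partial>M) < \<infinity>" .
qed (use nonneg in auto)

lemma sub_gaussian_integrable_norm:
  fixes P :: "'a::euclidean_space measure"
  assumes "prob_space P" and sets: "sets P = sets borel" and N: "is_norm N"
    and "sub_gaussian P N"
  shows "integrable P norm"
proof -
  interpret prob_space P by fact
  obtain C1 C2 where C: "C1 > 0" "C2 > 0"
    and tail: "\<And>\<tau>. \<tau> \<ge> 0 \<Longrightarrow> prob {z \<in> space P. \<tau> \<le> N z} \<le> C1 * exp (- C2 * \<tau>\<^sup>2)"
    using \<open>sub_gaussian P N\<close> by (auto simp: sub_gaussian_def)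
  have "N \<in> borel_measurable P"
    using borel_measurable_continuous_onI[OF is_norm_continuous_on[OF N]]
    by (simp add: measurable_cong_sets[OF sets refl])
  moreover have "summable (\<lambda>k. prob {z \<in> space P. real k \<le> N z})"
  proof (rule summable_comparison_test')
    show "summable (\<lambda>k. C1 * exp (- C2) ^ k)"
      using C by (intro summable_mult summable_geometric) simp
    fix k :: nat
    \<comment> \<open>\<open>k \<le> k\<^sup>2\<close> for natural \<open>k\<close> makes the Gaussian tail geometric.\<close>
    have "real k \<le> (real k)\<^sup>2"
      by (metis of_nat_le_iff of_nat_power power2_nat_le_imp_le le_square power2_eq_square)
    then have "exp (- C2 * (real k)\<^sup>2) \<le> exp (- C2) ^ k"
      using C by (simp add: exp_of_nat_mult[symmetric])
    then have "C1 * exp (- C2 * (real k)\<^sup>2) \<le> C1 * exp (- C2) ^ k"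
      using C by simp
    then show "norm (prob {z \<in> space P. real k \<le> N z}) \<le> C1 * exp (- C2) ^ k"
      using tail[of "real k"] by simp
  qed
  ultimately have int_N: "integrable P N"
    using N by (intro integrable_of_summable_tails) (auto simp: is_norm_def)
  obtain K where K: "\<And>x. norm x \<le> K * N x"
    using norm_le_is_norm[OF N] by blast
  have "norm \<in> borel_measurable P"
    by (simp add: measurable_cong_sets[OF sets refl])
  moreover have "norm (norm x) \<le> norm (K * N x)" for x
    using K[of x] by simp
  ultimately show ?thesis
    by (intro Bochner_Integration.integrable_bound[OF integrable_mult_right[OF int_N, of K]]) auto
qed

lemma integrable_affine:
  fixes P :: "'a::euclidean_space measure"
  assumes "prob_space P" and sets: "sets P = sets borel" and "integrable P norm"
  shows "integrable P (\<lambda>z. r + v \<bullet> z - s)"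
proof -
  interpret prob_space P by fact
  have "(\<lambda>z. z) \<in> borel_measurable P"
    by (simp add: measurable_cong_sets[OF sets refl])
  then have "integrable P (\<lambda>z. z)"
    using \<open>integrable P norm\<close> by (simp add: integrable_norm_iff)
  then show ?thesis
    by simp
qed

lemma integrable_Max:
  fixes f :: "'i \<Rightarrow> 'a \<Rightarrow> real"
  assumes "finite S" and "S \<noteq> {}" and "\<And>i. i \<in> S \<Longrightarrow> integrable M (f i)"
  shows "integrable M (\<lambda>z. MAX i\<in>S. f i z)"
  using assms by (induction rule: finite_ne_induct) simp_all

section \<open>From hinge expectations to the chance constraint\<close>

text \<open>Integrate the pointwise bound \<open>max (f z) 0 - \<beta> * indicator {f \<ge> 0} z \<le> max (f z - \<beta>) 0\<close>. The event
  includes \<open>f z = 0\<close>, where lowering the threshold already gains the full \<open>- \<beta>\<close>.\<close>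

lemma (in prob_space) hinge_expectation_gap:
  fixes f :: "'a \<Rightarrow> real"
  assumes f: "integrable M f" and "\<beta> \<le> 0"
  shows "expectation (\<lambda>z. max (f z) 0) - \<beta> * prob {z \<in> space M. 0 \<le> f z}
    \<le> expectation (\<lambda>z. max (f z - \<beta>) 0)"
proof -
  let ?E = "{z \<in> space M. 0 \<le> f z}"
  have [measurable]: "f \<in> borel_measurable M"
    using f by auto
  have E: "integrable M (\<lambda>z. \<beta> * indicator ?E z)"
    by (intro integrable_mult_right integrable_real_indicator) (auto simp: emeasure_eq_measure)
  have "expectation (\<lambda>z. max (f z) 0 - \<beta> * indicator ?E z) \<le> expectation (\<lambda>z. max (f z - \<beta>) 0)"
    using f E \<open>\<beta> \<le> 0\<close> by (intro integral_mono) (auto split: split_indicator)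
  moreover have "expectation (\<lambda>z. max (f z) 0 - \<beta> * indicator ?E z)
      = expectation (\<lambda>z. max (f z) 0) - \<beta> * prob ?E"
    using f E by (subst Bochner_Integration.integral_diff) auto
  ultimately show ?thesis by simp
qed

lemma chance_ok_of_negative_threshold:
  assumes "prob_space P" and f: "integrable P (g x)" and "\<beta> < 0"
    and better: "alsox_sharp_obj P \<epsilon> g (x, \<beta>) \<le> alsox_sharp_obj P \<epsilon> g (x, 0)"
  shows "chance_ok P \<epsilon> g x"
proof -
  interpret prob_space P by fact
  have [measurable]: "g x \<in> borel_measurable P"
    using f by auto
  have "\<epsilon> * \<beta> + expectation (\<lambda>z. max (g x z - \<beta>) 0) \<le> expectation (\<lambda>z. max (g x z) 0)"
    using better by (simp add: alsox_sharp_obj_def)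
  then have "\<epsilon> * \<beta> \<le> \<beta> * prob {z \<in> space P. 0 \<le> g x z}"
    using hinge_expectation_gap[OF f, of \<beta>] \<open>\<beta> < 0\<close> by linarith
  then have "prob {z \<in> space P. 0 \<le> g x z} \<le> \<epsilon>"
    using \<open>\<beta> < 0\<close> by (simp add: mult.commute)
  moreover have "prob {z \<in> space P. \<not> 0 \<le> g x z} = 1 - prob {z \<in> space P. 0 \<le> g x z}"
    by (intro prob_neg) simp
  moreover have "prob {z \<in> space P. \<not> 0 \<le> g x z} \<le> prob {z \<in> space P. g x z \<le> 0}"
    by (intro finite_measure_mono) auto
  ultimately show ?thesis
    by (simp add: chance_ok_def)
qed

lemma chance_ok_of_alsox_obj_nonpos:
  assumes "prob_space P" and f: "integrable P (g x)" and "0 \<le> \<epsilon>"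
    and "alsox_obj P g x \<le> 0"
  shows "chance_ok P \<epsilon> g x"
proof -
  interpret prob_space P by fact
  have [measurable]: "g x \<in> borel_measurable P"
    using f by auto
  have "alsox_obj P g x \<ge> 0"
    unfolding alsox_obj_def by (intro integral_nonneg_AE) simp
  with \<open>alsox_obj P g x \<le> 0\<close> have "(\<integral>z. max (g x z) 0 \<partial>P) = 0"
    unfolding alsox_obj_def by linarith
  then have "AE z in P. max (g x z) 0 = 0"
    using f by (subst (asm) integral_nonneg_eq_0_iff_AE) auto
  then have "AE z in P. g x z \<le> 0"
    by (rule AE_mp) (auto simp: max_def)
  then have "prob {z \<in> space P. g x z \<le> 0} = 1"
    by (subst prob_Collect_eq_1) simp_all
  then show ?thesis
    using \<open>0 \<le> \<epsilon>\<close> by (simp add: chance_ok_def)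
qed

section \<open>Comparison of the two approximations\<close>

lemma alsox_opt_of_sharp_opt_zero:
  assumes "alsox_sharp_opt P \<epsilon> g X c t (x, 0)"
  shows "alsox_opt P g X c t x"
proof -
  have zero: "alsox_sharp_obj P \<epsilon> g (y, 0) = alsox_obj P g y" for y
    by (simp add: alsox_sharp_obj_def alsox_obj_def)
  have "alsox_sharp_obj P \<epsilon> g (x, 0) \<le> alsox_sharp_obj P \<epsilon> g (y, 0)" if "y \<in> feasible X c t" for y
    using assms that by (auto simp: alsox_sharp_opt_def is_arg_min_linorder)
  moreover have "x \<in> feasible X c t"
    using assms by (auto simp: alsox_sharp_opt_def is_arg_min_linorder)
  ultimately show ?thesis
    by (simp add: alsox_opt_def is_arg_min_linorder zero)
qed

lemma alsox_obj_le_lower_value: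
  assumes "alsox_opt P g X c t x"
  shows "ereal (alsox_obj P g x) \<le> alsox_lower_value P g X c t"
  using assms unfolding alsox_lower_value_def
  by (intro INF_greatest) (auto simp: alsox_opt_def is_arg_min_linorder)

text \<open>Both cases of the argument at a fixed level, split by the sign of \<open>\<beta>\<close>. The ALSO-X solution
  \<open>y\<close> carries the chance constraint over to \<open>x\<close> when uniqueness identifies the two.\<close>

lemma chance_ok_of_sharp_opt:
  assumes "prob_space P" and "0 \<le> \<epsilon>"
    and int: "integrable P (g x)"
    and sharp: "alsox_sharp_opt P \<epsilon> g X c t (x, \<beta>)"
    and opt: "alsox_opt P g X c t y" "chance_ok P \<epsilon> g y"
    and unique: "0 < alsox_lower_value P g X c t \<Longrightarrow> \<exists>!x. alsox_opt P g X c t x"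
  shows "chance_ok P \<epsilon> g x"
proof (cases "\<beta> < 0")
  case True
  have "alsox_sharp_obj P \<epsilon> g (x, \<beta>) \<le> alsox_sharp_obj P \<epsilon> g (x, 0)"
    using sharp by (auto simp: alsox_sharp_opt_def is_arg_min_linorder)
  then show ?thesis
    by (rule chance_ok_of_negative_threshold[where g = g and x = x, OF assms(1) int True])
next
  case False
  then have "\<beta> = 0"
    using sharp by (auto simp: alsox_sharp_opt_def is_arg_min_linorder)
  then have x: "alsox_opt P g X c t x"
    using sharp by (simp add: alsox_opt_of_sharp_opt_zero)
  show ?thesis
  proof (cases "0 < alsox_lower_value P g X c t")
    case True
    then show ?thesis
      using unique opt x by blast
  next
    case False
    then have "ereal (alsox_obj P g x) \<le> 0"
      using alsox_obj_le_lower_value[OF x] order_trans not_less by metis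
    then show ?thesis
      using chance_ok_of_alsox_obj_nonpos[where g = g and x = x, OF assms(1) int \<open>0 \<le> \<epsilon>\<close>] by simp
  qed
qed

theorem theorem1:
  fixes P :: "(real ^ 'm) measure"
    and N :: "real ^ 'm \<Rightarrow> real"
    and X :: "(real ^ 'n) set"
    and c :: "real ^ 'n"
    and \<epsilon> \<theta> :: real
    and I :: nat
    and A :: "nat \<Rightarrow> real ^ 'n ^ 'm"
    and a :: "nat \<Rightarrow> real ^ 'm"
    and B :: "nat \<Rightarrow> real ^ 'n"
    and b :: "nat \<Rightarrow> real"
    and g :: "real ^ 'n \<Rightarrow> real ^ 'm \<Rightarrow> real"
  assumes "prob_space P" and "sets P = sets borel"
    and "is_norm N" and "sub_gaussian P N"
    and "0 < \<epsilon>" and "\<epsilon> < 1" and "0 \<le> \<theta>" and "1 \<le> I"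
    and g_def: "\<And>x z. g x z =
      (MAX i\<in>{1..I}. \<theta> * dual_norm N (A i *v x + a i) + (A i *v x + a i) \<bullet> z - (B i \<bullet> x + b i))"
    and alsox_attained:
      "\<And>t. feasible X c t \<noteq> {} \<Longrightarrow> \<exists>x. alsox_opt P g X c t x"
    and alsox_sharp_attained:
      "\<And>t. feasible X c t \<noteq> {} \<Longrightarrow> \<exists>x \<beta>. alsox_sharp_opt P \<epsilon> g X c t (x, \<beta>)"
    and unique:
      "\<And>t. feasible X c t \<noteq> {} \<Longrightarrow> 0 < alsox_lower_value P g X c t \<Longrightarrow> \<exists>!x. alsox_opt P g X c t x"
  shows "alsox_sharp_value P \<epsilon> g X c \<le> alsox_value P \<epsilon> g X c"
proof -
  have int: "integrable P (g x)" for x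
  proof -
    have "integrable P norm"
      using sub_gaussian_integrable_norm assms(1-4) by blast
    then have "integrable P (\<lambda>z. MAX i\<in>{1..I}.
        \<theta> * dual_norm N (A i *v x + a i) + (A i *v x + a i) \<bullet> z - (B i \<bullet> x + b i))"
      using \<open>1 \<le> I\<close> assms(1,2) by (intro integrable_Max integrable_affine) auto
    then show ?thesis
      by (simp add: g_def[abs_def])
  qed
  have "\<exists>x \<beta>. alsox_sharp_opt P \<epsilon> g X c t (x, \<beta>) \<and> chance_ok P \<epsilon> g x"
    if y: "alsox_opt P g X c t y" "chance_ok P \<epsilon> g y" for t y
  proof -
    have ne: "feasible X c t \<noteq> {}"
      using y(1) by (auto simp: alsox_opt_def is_arg_min_def)
    then obtain x \<beta> where sharp: "alsox_sharp_opt P \<epsilon> g X c t (x, \<beta>)"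
      using alsox_sharp_attained by blast
    have "chance_ok P \<epsilon> g x"
      using chance_ok_of_sharp_opt[OF assms(1) _ int sharp y unique[OF ne]] \<open>0 < \<epsilon>\<close> by simp
    then show ?thesis
      using sharp by blast
  qed
  then show ?thesis
    unfolding alsox_sharp_value_def alsox_value_def by (intro Inf_superset_mono) blast
qed

end
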